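(* Let $\Gamma$ be a highly dense numerical semigroup with embedding dimension $e$. Then $W_\Gamma(e)\geq 0$.
   Context: $\mathbb{N}$ denotes the set of nonnegative integers. A numerical semigroup $\Gamma$ is an additive submonoid of $(\mathbb{N},+)$ whose elements have greatest common divisor $1$, so that $\mathbb{N}\setminus\Gamma$ is finite; it is assumed that $\Gamma\neq\mathbb{N}$. The conductor is $c=c(\Gamma)=\max(\mathbb{N}\setminus\Gamma)+1$, and the delta-invariant $\delta(\Gamma)$ is the number of elements of $\Gamma$ (including $0$) that are smaller than $c$. The embedding dimension $e=e(\Gamma)$ is the cardinality of the minimal system of generators of $\Gamma$. The concentration of $\Gamma$ is $\mathbf{C}(\Gamma)=\max\{\operatorname{next}_\Gamma(s)-s : s\in\Gamma\setminus\{0\}\}$, where $\operatorname{next}_\Gamma(s)=\min\{x\in\Gamma : s<x\}$. $\Gamma$ is called highly dense if one of the following two conditions is satisfied: (1) $\mathbf{C}(\Gamma)\leq 2$; (2) $\mathbf{C}(\Gamma)\leq e(\Gamma)/2$ and $4\leq e(\Gamma)$. The Wilf function is $W_\Gamma:\mathbb{N}\to\mathbb{Z}$, $W_\Gamma(k)=k\,\delta(\Gamma)-c(\Gamma)$. *)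

theory Defs
  imports Complex_Main "HOL.Hull"
begin

definition submonoid :: "nat set \<Rightarrow> bool" where
  "submonoid G \<longleftrightarrow> 0 \<in> G \<and> (\<forall>x\<in>G. \<forall>y\<in>G. x + y \<in> G)"

definition numerical_semigroup :: "nat set \<Rightarrow> bool" where
  "numerical_semigroup G \<longleftrightarrow> submonoid G \<and> Gcd G = 1"

definition conductor :: "nat set \<Rightarrow> nat" where
  "conductor G = Max (UNIV - G) + 1"

definition delta :: "nat set \<Rightarrow> nat" where
  "delta G = card {x \<in> G. x < conductor G}"

definition minimal_generating_set :: "nat set \<Rightarrow> nat set \<Rightarrow> bool" where
  "minimal_generating_set G A \<longleftrightarrow>
     submonoid hull A = G \<and> (\<forall>B. B \<subset> A \<longrightarrow> submonoid hull B \<noteq> G)"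

text \<open>The description operator below is justified by \<open>ex1_minimal_generating_set\<close>.\<close>

definition embedding_dimension :: "nat set \<Rightarrow> nat" where
  "embedding_dimension G = card (THE A. minimal_generating_set G A)"

definition next_element :: "nat set \<Rightarrow> nat \<Rightarrow> nat" where
  "next_element G s = (LEAST x. x \<in> G \<and> s < x)"

definition concentration :: "nat set \<Rightarrow> nat" where
  "concentration G = Max {next_element G s - s | s. s \<in> G - {0}}"

definition highly_dense :: "nat set \<Rightarrow> bool" where
  "highly_dense G \<longleftrightarrow>
     concentration G \<le> 2 \<or>
     (real (concentration G) \<le> real (embedding_dimension G) / 2 \<and> 4 \<le> embedding_dimension G)"

definition wilf_function :: "nat set \<Rightarrow> nat \<Rightarrow> int" where
  "wilf_function G k = int k * int (delta G) - int (conductor G)"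

lemma submonoid_hull: "submonoid (submonoid hull A)"
  by (rule hull_in) (auto simp: submonoid_def)

lemma zero_in_hull: "0 \<in> submonoid hull A"
  and add_in_hull: "x \<in> submonoid hull A \<Longrightarrow> y \<in> submonoid hull A \<Longrightarrow> x + y \<in> submonoid hull A"
  using submonoid_hull[of A] unfolding submonoid_def[of "submonoid hull A"] by auto

lemma ex1_minimal_generating_set:
  assumes G: "submonoid G"
  shows "\<exists>!A. minimal_generating_set G A"
proof -
  define P where "P = {x \<in> G. x \<noteq> 0 \<and> (\<forall>y\<in>G. \<forall>z\<in>G. y \<noteq> 0 \<longrightarrow> z \<noteq> 0 \<longrightarrow> x \<noteq> y + z)}"
  have PG: "submonoid hull P = G"
  proof
    show "submonoid hull P \<subseteq> G"
      by (rule hull_minimal) (auto simp: P_def G)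
    have "x \<in> submonoid hull P" if "x \<in> G" for x
      using that
    proof (induction x rule: less_induct)
      case (less x)
      show ?case
      proof (cases "x = 0 \<or> x \<in> P")
        case True
        then show ?thesis
          using zero_in_hull[of P] hull_inc[of x P submonoid] by auto
      next
        case False
        then obtain y z where "y \<in> G" "z \<in> G" "y \<noteq> 0" "z \<noteq> 0" "x = y + z"
          using less.prems by (auto simp: P_def)
        then show ?thesis
          using less.IH[of y] less.IH[of z] by (auto intro: add_in_hull)
      qed
    qed
    then show "G \<subseteq> submonoid hull P" by blast
  qed
  have sub: "P \<subseteq> A" if A: "submonoid hull A = G" for A
  proof
    fix p assume p: "p \<in> P"
    show "p \<in> A"
    proof (rule ccontr)
      assume "p \<notin> A"
      have "A \<subseteq> G" using A hull_subset[of A submonoid] by simp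
      have "x + y \<noteq> p" if "x \<in> G - {p}" "y \<in> G - {p}" for x y
        using that p by (cases "x = 0"; cases "y = 0") (auto simp: P_def)
      then have "submonoid (G - {p})"
        using G p by (auto simp: submonoid_def P_def)
      then have "submonoid hull A \<subseteq> G - {p}"
        using \<open>A \<subseteq> G\<close> \<open>p \<notin> A\<close> by (intro hull_minimal) auto
      then show False using A p by (auto simp: P_def)
    qed
  qed
  show ?thesis
  proof
    show "minimal_generating_set G P"
      using PG sub unfolding minimal_generating_set_def by blast
    show "A = P" if "minimal_generating_set G A" for A
      using that PG sub unfolding minimal_generating_set_def by blast
  qed
qed

end

theory Submission
  imports Defs
begin

text \<open>
  Write \<open>m\<close> for the least nonzero element of \<open>G\<close>, \<open>c\<close> for the conductor, \<open>C\<close> for the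
  concentration and \<open>e\<close> for the embedding dimension, which is the number of atoms of \<open>G\<close> (nonzero
  elements that are not sums of two nonzero elements). The proof compares two consequences of the
  definitions. Above \<open>m\<close>, consecutive elements are at most \<open>C\<close> apart, so an interval \<open>[a, b)\<close> that
  starts at a nonzero element contains at least \<open>(b - a) / C\<close> elements
  (\<open>le_add_concentration_mult_card\<close>); this bounds \<open>\<delta>\<close> from below. On the other hand every element
  of \<open>[m, 2m)\<close> is an atom, because a sum of two nonzero elements is at least \<open>2 m\<close>; this bounds \<open>e\<close>
  from below.

  Suppose first that \<open>2 C \<le> e + 1\<close> (\<open>conductor_le_of_concentration\<close>). If \<open>2 m \<le> c\<close>, let \<open>k\<close> and
  \<open>l\<close> count the elements of \<open>[m, 2m)\<close> and of \<open>[2m, c)\<close>. Then \<open>\<delta> = 1 + k + l\<close>, \<open>k \<le> e\<close>, and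
  \<open>c \<le> 2 m + C l \<le> 2 C k + C l \<le> (e + 1) k + e l \<le> e (1 + k + l)\<close>. If \<open>c < 2 m\<close>, let \<open>k\<close> count
  the elements of \<open>[m, c)\<close>. Then \<open>\<delta> = 1 + k\<close>, and all of \<open>[c, 2m)\<close> consists of atoms as well, so
  \<open>2 m - c \<le> e - k\<close>; together with \<open>c \<le> m + C k\<close> this gives
  \<open>c \<le> (2 m - c) + 2 C k \<le> e - k + (e + 1) k = e \<delta>\<close>.

  A highly dense semigroup violates \<open>2 C \<le> e + 1\<close> only if \<open>C = 2\<close> and \<open>e \<le> 2\<close>. The case \<open>e = 1\<close>
  would make \<open>G\<close> consist of the multiples of \<open>m\<close>, hence \<open>m = 1\<close>. In the case \<open>e = 2\<close> the two
  bounds give \<open>m \<le> 2 e = 4\<close>, and the few possibilities are examined directly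
  (\<open>conductor_le_two_atoms\<close>).
\<close>

section \<open>Atoms\<close>

definition atoms :: "nat set \<Rightarrow> nat set" where
  "atoms G = {x \<in> G. x \<noteq> 0 \<and> (\<forall>y\<in>G. \<forall>z\<in>G. y \<noteq> 0 \<longrightarrow> z \<noteq> 0 \<longrightarrow> x \<noteq> y + z)}"

lemma submonoid_mult:
  assumes "submonoid G" "x \<in> G"
  shows "n * x \<in> G"
  using assms by (induction n) (auto simp: submonoid_def)

text \<open>
  Splitting an element that is not an atom makes both summands smaller, so the process ends with atoms.
\<close>

lemma hull_atoms:
  assumes G: "submonoid G"
  shows "submonoid hull atoms G = G"
proof
  show "submonoid hull atoms G \<subseteq> G"
    by (rule hull_minimal) (auto simp: atoms_def G)
  have "x \<in> submonoid hull atoms G" if "x \<in> G" for x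
    using that
  proof (induction x rule: less_induct)
    case (less x)
    show ?case
    proof (cases "x = 0 \<or> x \<in> atoms G")
      case True
      then show ?thesis
        using zero_in_hull hull_inc[of x "atoms G" submonoid] by auto
    next
      case False
      then obtain y z where "y \<in> G" "z \<in> G" "y \<noteq> 0" "z \<noteq> 0" "x = y + z"
        using less.prems by (auto simp: atoms_def)
      then show ?thesis
        using less.IH[of y] less.IH[of z] by (auto intro: add_in_hull)
    qed
  qed
  then show "G \<subseteq> submonoid hull atoms G" by blast
qed

text \<open>
  Removing an atom from a submonoid leaves a submonoid; so generators that avoid the atom
  cannot produce it. With \<open>hull_atoms\<close>, the atoms are therefore the minimal generating set.
\<close>

lemma atoms_subset_generators:
  assumes G: "submonoid G" and A: "submonoid hull A = G"
  shows "atoms G \<subseteq> A"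
proof (rule ccontr)
  assume "\<not> atoms G \<subseteq> A"
  then obtain p where p: "p \<in> atoms G" "p \<notin> A" by blast
  have "x + y \<noteq> p" if "x \<in> G - {p}" "y \<in> G - {p}" for x y
    using that p by (cases "x = 0"; cases "y = 0") (auto simp: atoms_def)
  then have "submonoid (G - {p})"
    using G p by (auto simp: submonoid_def atoms_def)
  moreover have "A \<subseteq> G" using A hull_subset[of A submonoid] by simp
  ultimately have "submonoid hull A \<subseteq> G - {p}"
    using p by (intro hull_minimal) auto
  then show False using A p by (auto simp: atoms_def)
qed

lemma embedding_dimension_eq_card_atoms:
  assumes G: "submonoid G"
  shows "embedding_dimension G = card (atoms G)"
proof -
  have "minimal_generating_set G (atoms G)"
    using hull_atoms[OF G] atoms_subset_generators[OF G]
    unfolding minimal_generating_set_def by blast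
  then have "(THE A. minimal_generating_set G A) = atoms G"
    by (rule the1_equality[OF ex1_minimal_generating_set[OF G]])
  then show ?thesis by (simp add: embedding_dimension_def)
qed

lemma common_divisor_of_atoms:
  assumes G: "numerical_semigroup G" and d: "\<And>p. p \<in> atoms G \<Longrightarrow> d dvd p"
  shows "d = 1"
proof -
  have "submonoid {x. d dvd x}" by (auto simp: submonoid_def)
  then have "submonoid hull atoms G \<subseteq> {x. d dvd x}"
    using d by (intro hull_minimal) auto
  then have "\<forall>x\<in>G. d dvd x"
    using G hull_atoms[of G] by (auto simp: numerical_semigroup_def)
  then have "d dvd Gcd G" by (auto intro: Gcd_greatest)
  then show ?thesis using G by (simp add: numerical_semigroup_def)
qed

section \<open>Conductor\<close>

text \<open>
  The least positive difference \<open>d\<close> of two elements divides every element \<open>x\<close>: the remainder of \<open>x\<close>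
  modulo \<open>d\<close> is again a difference of two elements. Hence \<open>d\<close> divides the gcd.
\<close>

lemma consecutive_elements:
  assumes G: "numerical_semigroup G"
  shows "\<exists>b\<in>G. b + 1 \<in> G"
proof -
  have mon: "submonoid G" and gcd: "Gcd G = 1"
    using G by (auto simp: numerical_semigroup_def)
  have add: "x + y \<in> G" if "x \<in> G" "y \<in> G" for x y
    using that mon by (auto simp: submonoid_def)
  define D where "D d \<longleftrightarrow> d > 0 \<and> (\<exists>b\<in>G. b + d \<in> G)" for d
  have "\<not> G \<subseteq> {0}" using gcd by (metis Gcd_0_iff zero_neq_one)
  then obtain x where "x \<in> G" "x > 0" by auto
  then have "D x" using mon by (auto simp: D_def submonoid_def intro!: bexI[of _ 0])
  define d where "d = (LEAST d. D d)"
  have "D d" unfolding d_def using \<open>D x\<close> by (rule LeastI)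
  then obtain b where b: "d > 0" "b \<in> G" "b + d \<in> G" by (auto simp: D_def)
  have "d dvd x" if x: "x \<in> G" for x
  proof (rule ccontr)
    assume "\<not> d dvd x"
    then have r: "x mod d > 0" by (simp add: dvd_eq_mod_eq_0)
    \<comment> \<open>Adding \<open>x div d * b\<close> on both sides of \<open>x = x div d * d + x mod d\<close> avoids subtraction:
      the multiple of \<open>d\<close> need not lie in \<open>G\<close>, but that of \<open>b + d\<close> does.\<close>
    have "x div d * (b + d) + x mod d = x + x div d * b"
      by (simp add: algebra_simps)
    moreover have "x + x div d * b \<in> G" "x div d * (b + d) \<in> G"
      using b x by (auto intro: add submonoid_mult[OF mon])
    ultimately have "D (x mod d)" using r unfolding D_def by metis
    moreover have "x mod d < d" using b by simp
    ultimately show False unfolding d_def using not_less_Least by blast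
  qed
  then have "d dvd Gcd G" by (auto intro: Gcd_greatest)
  then have "d = 1" using gcd by simp
  then show ?thesis using b by auto
qed

text \<open>
  If \<open>b\<close> and \<open>b + 1\<close> are elements, so is every \<open>n = q b + r\<close> with \<open>r \<le> q\<close>, being
  \<open>(q - r) b + r (b + 1)\<close>; and \<open>r < b \<le> q\<close> holds for the division of any \<open>n \<ge> b\<^sup>2\<close> by \<open>b > 0\<close>.
\<close>

lemma finite_gaps:
  assumes G: "numerical_semigroup G"
  shows "finite (UNIV - G)"
proof -
  have mon: "submonoid G" using G by (auto simp: numerical_semigroup_def)
  obtain b where b: "b \<in> G" "b + 1 \<in> G" using consecutive_elements[OF G] by blast
  have "n \<in> G" if n: "n \<ge> b * b" for n
  proof (cases "b = 0")
    case True
    then show ?thesis using submonoid_mult[OF mon b(2), of n] by simp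
  next
    case False
    have "n mod b \<le> n div b"
      using False div_le_mono[OF n, of b] mod_less_divisor[of b n]
      by (metis less_imp_le nonzero_mult_div_cancel_right not_gr_zero order_trans)
    then have "(n div b - n mod b) * b + n mod b * b = n div b * b"
      by (metis add_mult_distrib le_add_diff_inverse2)
    then have "(n div b - n mod b) * b + n mod b * (b + 1) = n"
      using div_mult_mod_eq[of n b] unfolding distrib_left by linarith
    moreover have "(n div b - n mod b) * b + n mod b * (b + 1) \<in> G"
      using mon submonoid_mult[OF mon b(1)] submonoid_mult[OF mon b(2)]
      by (auto simp: submonoid_def)
    ultimately show ?thesis by simp
  qed
  then have "UNIV - G \<subseteq> {..<b * b}" by (auto simp: not_le[symmetric])
  then show ?thesis using finite_subset by blast
qed

section \<open>Counting elements between the multiplicity and the conductor\<close>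

definition multiplicity :: "nat set \<Rightarrow> nat" where
  "multiplicity G = (LEAST x. x \<in> G \<and> x \<noteq> 0)"

locale proper_numerical_semigroup =
  fixes G :: "nat set" and m c C :: nat
  assumes G: "numerical_semigroup G" and proper: "G \<noteq> UNIV"
  defines "m \<equiv> multiplicity G" and "c \<equiv> conductor G" and "C \<equiv> concentration G"
begin

lemma mon: "submonoid G"
  using G by (simp add: numerical_semigroup_def)

lemma zero_mem: "0 \<in> G" and add_mem: "x \<in> G \<Longrightarrow> y \<in> G \<Longrightarrow> x + y \<in> G"
  using mon by (auto simp: submonoid_def)

lemma one_not_mem: "1 \<notin> G"
proof
  assume "1 \<in> G"
  then have "n \<in> G" for n using submonoid_mult[OF mon, of 1 n] by simp
  then show False using proper by blast
qed

lemma multiplicity_mem: "m \<in> G" "m \<noteq> 0"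
proof -
  have "\<exists>x. x \<in> G \<and> x \<noteq> 0"
    using G Gcd_0_iff[of G] by (auto simp: numerical_semigroup_def)
  then have "m \<in> G \<and> m \<noteq> 0" unfolding m_def multiplicity_def by (rule LeastI_ex)
  then show "m \<in> G" "m \<noteq> 0" by auto
qed

lemma multiplicity_le: "x \<in> G \<Longrightarrow> x \<noteq> 0 \<Longrightarrow> m \<le> x"
  unfolding m_def multiplicity_def by (auto intro: Least_le)

lemma multiplicity_ge_2: "m \<ge> 2"
proof -
  have "m \<noteq> 1" using multiplicity_mem one_not_mem by auto
  then show ?thesis using multiplicity_mem(2) by linarith
qed

lemma conductor_le_mem: "c \<le> n \<Longrightarrow> n \<in> G"
  using Max_ge[OF finite_gaps[OF G], of n]
  unfolding c_def conductor_def by auto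

lemma conductor_pred_not_mem: "c - 1 \<notin> G"
  using Max_in[OF finite_gaps[OF G]] proper
  unfolding c_def conductor_def by auto

lemma multiplicity_le_conductor: "m \<le> c"
  using multiplicity_le[OF conductor_le_mem[of c]] by (simp add: c_def conductor_def)

text \<open>
  An element \<open>x \<ge> c + m\<close> splits as \<open>m + (x - m)\<close>. The bound serves to make the set of atoms finite, so
  that its cardinality is a meaningful embedding dimension.
\<close>

lemma atom_less:
  assumes "x \<in> atoms G"
  shows "x < c + m"
proof (rule ccontr)
  assume "\<not> x < c + m"
  then have "x - m \<in> G" "x = m + (x - m)" "x - m \<noteq> 0"
    using conductor_le_mem[of "x - m"] multiplicity_le_conductor multiplicity_mem(2) by auto
  then show False using assms multiplicity_mem unfolding atoms_def by blast
qed

lemma finite_atoms: "finite (atoms G)"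
proof (rule finite_subset)
  show "atoms G \<subseteq> {..<c + m}" using atom_less by blast
qed simp

lemma atomI:
  assumes "x \<in> G" "0 < x" "x < 2 * m"
  shows "x \<in> atoms G"
proof -
  have "x \<noteq> y + z" if "y \<in> G" "z \<in> G" "y \<noteq> 0" "z \<noteq> 0" for y z
    using multiplicity_le[OF that(1,3)] multiplicity_le[OF that(2,4)] assms(3) by linarith
  then show ?thesis using assms(1,2) by (simp add: atoms_def)
qed

text \<open>
  The concentration is a maximum over an infinite index set; it is attained because
  \<open>s + m\<close> always follows \<open>s\<close>, so that the values are bounded by \<open>m\<close>.
\<close>

lemma next_within_concentration:
  assumes s: "s \<in> G" "s \<noteq> 0"
  shows "\<exists>x\<in>G. s < x \<and> x \<le> s + C"
proof -
  let ?N = "{next_element G s - s | s. s \<in> G - {0}}"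
  have succ: "t + m \<in> G \<and> t < t + m" if "t \<in> G" for t
    using that add_mem multiplicity_mem by auto
  have "next_element G t - t \<le> m" if "t \<in> G" for t
    using Least_le[of "\<lambda>x. x \<in> G \<and> t < x", OF succ[OF that]] unfolding next_element_def by simp
  then have "?N \<subseteq> {..m}" by blast
  then have "finite ?N" by (rule finite_subset) simp
  then have "next_element G s - s \<le> C"
    unfolding C_def concentration_def using s by (intro Max_ge) auto
  moreover have "next_element G s \<in> G \<and> s < next_element G s"
    unfolding next_element_def using succ[OF s(1)] by (rule LeastI)
  ultimately show ?thesis by (intro bexI[of _ "next_element G s"]) auto
qed

lemma concentration_pos: "C > 0"
  using next_within_concentration[OF multiplicity_mem] by auto

text \<open>
  Walking from \<open>a\<close> to \<open>b\<close> along the elements takes one step of length at most \<open>C\<close> for each element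
  of \<open>[a, b)\<close>.
\<close>

lemma le_add_concentration_mult_card:
  assumes "a \<in> G" "a \<noteq> 0"
  shows "b \<le> a + C * card (G \<inter> {a..<b})"
  using assms
proof (induction "b - a" arbitrary: a rule: less_induct)
  case less
  show ?case
  proof (cases "a < b")
    case True
    obtain x where x: "x \<in> G" "a < x" "x \<le> a + C"
      using next_within_concentration less.prems by blast
    have "b \<le> x + C * card (G \<inter> {x..<b})" using less.hyps[of x] x True by simp
    also have "\<dots> \<le> a + C * Suc (card (G \<inter> {x..<b}))" using x by simp
    also have "Suc (card (G \<inter> {x..<b})) = card (insert a (G \<inter> {x..<b}))"
      using x by simp
    also have "\<dots> \<le> card (G \<inter> {a..<b})"
      using x True less.prems by (intro card_mono) auto
    finally show ?thesis by simp
  qed simp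
qed

lemma delta_eq: "delta G = 1 + card (G \<inter> {m..<c})"
proof -
  have "{x \<in> G. x < conductor G} = insert 0 (G \<inter> {m..<c})"
    using zero_mem multiplicity_le multiplicity_le_conductor multiplicity_mem
    by (auto simp: c_def)
  then show ?thesis unfolding delta_def using multiplicity_mem by simp
qed

lemma card_below_twice_multiplicity_le: "card (G \<inter> {m..<2 * m}) \<le> card (atoms G)"
proof (rule card_mono[OF finite_atoms])
  show "G \<inter> {m..<2 * m} \<subseteq> atoms G" using atomI multiplicity_mem(2) by fastforce
qed

lemma delta_eq_split:
  assumes "2 * m \<le> c"
  shows "delta G = 1 + card (G \<inter> {m..<2 * m}) + card (G \<inter> {2 * m..<c})"
proof -
  have "G \<inter> {m..<c} = (G \<inter> {m..<2 * m}) \<union> (G \<inter> {2 * m..<c})" using assms by auto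
  moreover have "(G \<inter> {m..<2 * m}) \<inter> (G \<inter> {2 * m..<c}) = {}" by auto
  ultimately show ?thesis unfolding delta_eq by (simp add: card_Un_disjoint)
qed

lemma twice_multiplicity_mem: "2 * m \<in> G" "2 * m \<noteq> 0"
  using multiplicity_mem add_mem[of m m] by (simp_all add: mult_2)

lemma card_atoms_ge_of_conductor_less:
  assumes "c < 2 * m"
  shows "card (G \<inter> {m..<c}) + (2 * m - c) \<le> card (atoms G)"
proof -
  have "G \<inter> {m..<2 * m} = (G \<inter> {m..<c}) \<union> {c..<2 * m}"
    using assms conductor_le_mem multiplicity_le_conductor by auto
  moreover have "(G \<inter> {m..<c}) \<inter> {c..<2 * m} = {}" by auto
  ultimately show ?thesis
    using card_below_twice_multiplicity_le by (simp add: card_Un_disjoint)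
qed

section \<open>Wilf's inequality\<close>

text \<open>
  The hypothesis \<open>2 C \<le> e + 1\<close> is weaker than the bound \<open>2 C \<le> e\<close> in the definition of high
  density. The slack is absorbed by \<open>k \<le> e\<close> in the first case and by the summand \<open>k\<close> of
  \<open>k + (2 m - c) \<le> e\<close> in the second; it brings \<open>C = 2\<close>, \<open>e = 3\<close> under the general argument.
\<close>

lemma conductor_le_of_concentration:
  assumes C: "2 * C \<le> card (atoms G) + 1"
  shows "c \<le> card (atoms G) * delta G"
proof (cases "2 * m \<le> c")
  case True
  let ?e = "card (atoms G)"
  define k l where "k = card (G \<inter> {m..<2 * m})" and "l = card (G \<inter> {2 * m..<c})"
  have "m \<le> C * k"
    using le_add_concentration_mult_card[OF multiplicity_mem, of "2 * m"] by (simp add: k_def)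
  moreover have "c \<le> 2 * m + C * l"
    using le_add_concentration_mult_card[OF twice_multiplicity_mem, of c] by (simp add: l_def)
  ultimately have "c \<le> 2 * C * k + C * l" by simp
  also have "\<dots> \<le> (?e + 1) * k + ?e * l"
    using C concentration_pos by (intro add_mono mult_right_mono) auto
  also have "\<dots> \<le> ?e * (1 + k + l)"
    using card_below_twice_multiplicity_le by (simp add: k_def algebra_simps)
  finally show ?thesis using delta_eq_split[OF True] by (simp add: k_def l_def)
next
  case False
  let ?e = "card (atoms G)"
  define k where "k = card (G \<inter> {m..<c})"
  have "c \<le> m + C * k"
    using le_add_concentration_mult_card[OF multiplicity_mem, of c] by (simp add: k_def)
  moreover have "k + (2 * m - c) \<le> ?e"
    using card_atoms_ge_of_conductor_less False by (simp add: k_def)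
  ultimately have "c + k \<le> ?e + 2 * C * k" using False by simp
  also have "\<dots> \<le> ?e + (?e + 1) * k" using C by (intro add_left_mono mult_right_mono) auto
  finally show ?thesis unfolding delta_eq k_def[symmetric] by (simp add: algebra_simps)
qed

text \<open>A single atom divides every element, so it is 1, but \<open>m \<ge> 2\<close>.\<close>

lemma card_atoms_ge_2: "card (atoms G) \<ge> 2"
proof (rule ccontr)
  assume "\<not> ?thesis"
  moreover have m: "m \<in> atoms G" using atomI[of m] multiplicity_mem by simp
  ultimately have "card (atoms G) = 1"
    using card_gt_0_iff[of "atoms G"] finite_atoms by (auto simp: not_le less_2_cases_iff)
  then have "atoms G = {m}" using m by (auto simp: card_1_singleton_iff)
  then have "m = 1" using common_divisor_of_atoms[OF G, of m] by simp
  then show False using multiplicity_ge_2 by simp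
qed

text \<open>
  As \<open>m \<le> 4\<close>, only small semigroups occur. If \<open>m = 2\<close>, the steps from \<open>m\<close> to \<open>c\<close> have length at most 2
  and \<open>c \<le> 2 + 2 (\<delta> - 1)\<close>. If \<open>m = 3\<close> and \<open>6 \<le> c\<close>, the interval \<open>[3, 6)\<close> contains two elements,
  which gains the missing unit by rounding. The remaining configurations have a third atom or, for
  \<open>m = 4\<close>, the common divisor 2.
\<close>

lemma conductor_le_two_atoms:
  assumes e: "card (atoms G) = 2" and C: "C \<le> 2"
  shows "c \<le> 2 * delta G"
proof -
  have three: False if "{x, y, z} \<subseteq> atoms G" "x < y" "y < z" for x y z
    using card_mono[OF finite_atoms that(1)] that e by simp
  have next2: "x + 1 \<in> G \<or> x + 2 \<in> G" if "x \<in> G" "x \<noteq> 0" for x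
  proof -
    obtain y where "y \<in> G" "x < y" "y \<le> x + C"
      using next_within_concentration[OF \<open>x \<in> G\<close> \<open>x \<noteq> 0\<close>] by blast
    moreover then have "y = x + 1 \<or> y = x + 2" using C by linarith
    ultimately show ?thesis by auto
  qed
  have le2: "b \<le> a + 2 * card (G \<inter> {a..<b})" if "a \<in> G" "a \<noteq> 0" for a b
    using le_add_concentration_mult_card[OF that, of b] C
    by (meson add_left_mono le_trans mult_le_mono1)
  have k: "m \<le> 2 * card (G \<inter> {m..<2 * m})"
    using le2[OF multiplicity_mem, of "2 * m"] by simp
  then have "m \<le> 4" using card_below_twice_multiplicity_le e by simp
  then consider "m = 2" | "m = 3" | "m = 4" using multiplicity_ge_2 by linarith
  then show ?thesis
  proof cases
    case 1
    then show ?thesis using le2[OF multiplicity_mem, of c] by (simp add: delta_eq)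
  next
    case 2
    show ?thesis
    proof (cases "2 * m \<le> c")
      case True
      have "2 \<le> card (G \<inter> {m..<2 * m})" using k 2 by linarith
      then show ?thesis
        using 2 le2[OF twice_multiplicity_mem, of c] delta_eq_split[OF True] by simp
    next
      case False
      \<comment> \<open>\<open>c = 3\<close> makes 3, 4, 5 atoms, and \<open>c = 5\<close> makes 3, 5, 7 atoms.\<close>
      have "c \<noteq> 3" using card_atoms_ge_of_conductor_less 2 e by auto
      moreover have "c \<noteq> 4" using conductor_pred_not_mem multiplicity_mem 2 by auto
      ultimately have "c = 5" using False 2 multiplicity_le_conductor by simp
      have "4 \<notin> G" using conductor_pred_not_mem \<open>c = 5\<close> by simp
      have "7 \<in> atoms G"
      proof -
        have False if "y \<in> G" "z \<in> G" "y \<noteq> 0" "z \<noteq> 0" "7 = y + z" for y z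
        proof -
          have "3 \<le> y" "3 \<le> z" using multiplicity_le that 2 by auto
          then have "y = 4 \<or> z = 4" using that(5) by linarith
          then show False using that \<open>4 \<notin> G\<close> by auto
        qed
        then show ?thesis using conductor_le_mem[of 7] \<open>c = 5\<close> by (auto simp: atoms_def)
      qed
      moreover have "3 \<in> atoms G" "5 \<in> atoms G"
        using atomI[of 3] atomI[of 5] multiplicity_mem 2 conductor_le_mem[of 5] \<open>c = 5\<close> by auto
      ultimately show ?thesis using three[of 3 5 7] by simp
    qed
  next
    case 3
    have atom: "x \<in> atoms G" if "x \<in> G" "0 < x" "x < 8" for x
      using atomI that 3 by simp
    have "4 \<in> G" using multiplicity_mem 3 by simp
    have "5 \<notin> G"
    proof
      assume "5 \<in> G"
      then have "6 \<in> G \<or> 7 \<in> G" using next2[of 5] by simp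
      then show False using three[of 4 5 6] three[of 4 5 7] atom \<open>4 \<in> G\<close> \<open>5 \<in> G\<close> by auto
    qed
    then have "6 \<in> G" using next2[of 4] \<open>4 \<in> G\<close> by simp
    then have sub: "{4, 6} \<subseteq> atoms G" using atom \<open>4 \<in> G\<close> by simp
    then have "{4, 6} = atoms G" using e finite_atoms by (intro card_subset_eq) auto
    then have "2 dvd p" if "p \<in> atoms G" for p using that by (metis insertE singletonD even_numeral)
    then have "(2::nat) = 1" by (rule common_divisor_of_atoms[OF G])
    then show ?thesis by simp
  qed
qed

end

theorem proposition5p2:
  fixes \<Gamma> :: "nat set" and e :: nat
  assumes "numerical_semigroup \<Gamma>"
    and "\<Gamma> \<noteq> UNIV"
    and "highly_dense \<Gamma>"
    and "e = embedding_dimension \<Gamma>"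
  shows "wilf_function \<Gamma> e \<ge> 0"
proof -
  interpret proper_numerical_semigroup \<Gamma> "multiplicity \<Gamma>" "conductor \<Gamma>" "concentration \<Gamma>"
    using assms(1,2) by unfold_locales auto
  have e: "e = card (atoms \<Gamma>)"
    using assms(4) embedding_dimension_eq_card_atoms[OF mon] by simp
  have "concentration \<Gamma> \<le> 2 \<or> 2 * concentration \<Gamma> \<le> e"
    using assms(3,4) by (auto simp: highly_dense_def)
  \<comment> \<open>Concentration at most 2 satisfies the first alternative as soon as \<open>e \<ge> 3\<close>.\<close>
  then consider "2 * concentration \<Gamma> \<le> e + 1" | "concentration \<Gamma> \<le> 2" "e = 2"
    using card_atoms_ge_2 e by linarith
  then have "conductor \<Gamma> \<le> e * delta \<Gamma>"
    using conductor_le_of_concentration conductor_le_two_atoms e by cases auto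
  then show ?thesis
    unfolding wilf_function_def by (simp flip: of_nat_mult)
qed

end
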